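(* There are exactly $2^4\cdot 5!=1920$ magic-faced tesseracts, and hence exactly $1920$ arrangements of the numbers $1,\dots,16$ in a $4\times4$ square such that every row, every column, and every $2\times2$ subsquare (including those that wrap around) sums to the magic constant $34$. These are all equivalent to each other under a natural, faithful action of the group $\mathrm{Aut}(FQ_4)\cong C_2^4\rtimes S_5$, of order $1920$.
   Context: $Q_4$ is the hypercube graph on $\{0,1\}^4$ (adjacent iff differing in exactly one coordinate). A magic-faced tesseract is a bijective labeling of the vertices of $Q_4$ by $1,\ldots,16$ such that every $4$-cycle of $Q_4$ (equivalently, every $2\times 2$ face) has the same sum of labels. $FQ_4$ is the folded hypercube graph: $Q_4$ together with an edge joining each pair of antipodal vertices (vertices differing in all $4$ coordinates). In $C_2^4\rtimes S_5$, $C_2^4$ is identified with $\mathbb F_2^5/\langle e_0+\cdots+e_4\rangle$ and $S_5$ permutes the standard basis vectors $e_0,\ldots,e_4$. Positions of a $4\times 4$ square are viewed as vertices of the toroidal grid graph $C_4\times C_4$ (Cartesian product of two $4$-cycles), which is isomorphic as a graph to $Q_4$; a $2\times2$ subsquare consists of the positions $\{i,i+1\}\times\{j,j+1\}$ with indices modulo $4$. The natural action is: $\mathrm{Aut}(FQ_4)$ permutes the vertices of $FQ_4$, i.e. the vertices of $Q_4$, hence acts on labelings of $Q_4$, and (via a fixed graph isomorphism $C_4\times C_4\cong Q_4$) on arrangements in the $4\times 4$ square. *)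

theory Defs
  imports
    "HOL-Analysis.Finite_Cartesian_Product"
    "HOL-Library.Z2"
    "HOL-Library.Numeral_Type"
    "HOL-Algebra.Generated_Groups"
    "HOL-Algebra.Group_Action"
begin

section \<open>Graphs\<close>

text \<open>
  A simple graph whose vertex set is a whole type is given by its (symmetric, irreflexive)
  adjacency predicate.
\<close>

definition graph_iso :: "('a \<Rightarrow> 'a \<Rightarrow> bool) \<Rightarrow> ('b \<Rightarrow> 'b \<Rightarrow> bool) \<Rightarrow> ('a \<Rightarrow> 'b) \<Rightarrow> bool" where
  "graph_iso E F \<phi> \<longleftrightarrow> bij \<phi> \<and> (\<forall>x y. E x y \<longleftrightarrow> F (\<phi> x) (\<phi> y))"

definition Aut :: "('a \<Rightarrow> 'a \<Rightarrow> bool) \<Rightarrow> ('a \<Rightarrow> 'a) monoid" where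
  "Aut E = \<lparr>carrier = {\<sigma>. graph_iso E E \<sigma>}, mult = (\<circ>), one = id\<rparr>"

definition four_cycle :: "('a \<Rightarrow> 'a \<Rightarrow> bool) \<Rightarrow> 'a \<Rightarrow> 'a \<Rightarrow> 'a \<Rightarrow> 'a \<Rightarrow> bool" where
  "four_cycle E a b c d \<longleftrightarrow> distinct [a, b, c, d] \<and> E a b \<and> E b c \<and> E c d \<and> E d a"

definition hypercube :: "bit ^ 4 \<Rightarrow> bit ^ 4 \<Rightarrow> bool" where
  "hypercube x y \<longleftrightarrow> card {i. x $ i \<noteq> y $ i} = 1"

definition folded_hypercube :: "bit ^ 4 \<Rightarrow> bit ^ 4 \<Rightarrow> bool" where
  "folded_hypercube x y \<longleftrightarrow> hypercube x y \<or> card {i. x $ i \<noteq> y $ i} = 4"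

text \<open>The elements of the type \<open>4\<close> are the integers modulo 4; its addition wraps around.\<close>

definition cycle4 :: "4 \<Rightarrow> 4 \<Rightarrow> bool" where
  "cycle4 i j \<longleftrightarrow> j = i + 1 \<or> i = j + 1"

definition cartesian_product ::
    "('a \<Rightarrow> 'a \<Rightarrow> bool) \<Rightarrow> ('b \<Rightarrow> 'b \<Rightarrow> bool) \<Rightarrow> 'a \<times> 'b \<Rightarrow> 'a \<times> 'b \<Rightarrow> bool" where
  "cartesian_product E F p q \<longleftrightarrow>
     fst p = fst q \<and> F (snd p) (snd q) \<or> E (fst p) (fst q) \<and> snd p = snd q"

definition torus_grid :: "4 \<times> 4 \<Rightarrow> 4 \<times> 4 \<Rightarrow> bool" where
  "torus_grid = cartesian_product cycle4 cycle4"


section \<open>Magic labelings\<close>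

definition magic_faced_tesseracts :: "(bit ^ 4 \<Rightarrow> nat) set" where
  "magic_faced_tesseracts =
     {f. bij_betw f UNIV {1..16} \<and>
         (\<exists>s. \<forall>a b c d. four_cycle hypercube a b c d \<longrightarrow> f a + f b + f c + f d = s)}"

definition magic_arrangements :: "(4 \<times> 4 \<Rightarrow> nat) set" where
  "magic_arrangements =
     {A. bij_betw A UNIV {1..16} \<and>
         (\<forall>i. (\<Sum>j\<in>UNIV. A (i, j)) = 34) \<and>
         (\<forall>j. (\<Sum>i\<in>UNIV. A (i, j)) = 34) \<and>
         (\<forall>i j. A (i, j) + A (i, j + 1) + A (i + 1, j) + A (i + 1, j + 1) = 34)}"


section \<open>The actions on labelings\<close>

text \<open>
  A permutation \<open>\<sigma>\<close> of the vertices moves the label of \<open>v\<close> to \<open>\<sigma> v\<close>. Maps are restricted to the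
  set \<open>L\<close> of labelings acted upon because \<^const>\<open>BijGroup\<close> consists of extensional functions.
\<close>

definition labeling_action :: "('v \<Rightarrow> 'l) set \<Rightarrow> ('v \<Rightarrow> 'v) \<Rightarrow> ('v \<Rightarrow> 'l) \<Rightarrow> 'v \<Rightarrow> 'l" where
  "labeling_action L \<sigma> = (\<lambda>f\<in>L. f \<circ> inv_into UNIV \<sigma>)"

text \<open>
  A permutation \<open>\<sigma>\<close> of \<open>'v\<close> acts on labelings of \<open>'p\<close> through the bijection \<open>\<phi>\<close>, i.e. through the
  permutation \<open>\<phi>\<inverse> \<circ> \<sigma> \<circ> \<phi>\<close> of \<open>'p\<close>.
\<close>

definition transported_action ::
    "('p \<Rightarrow> 'v) \<Rightarrow> ('p \<Rightarrow> 'l) set \<Rightarrow> ('v \<Rightarrow> 'v) \<Rightarrow> ('p \<Rightarrow> 'l) \<Rightarrow> 'p \<Rightarrow> 'l" where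
  "transported_action \<phi> L \<sigma> = labeling_action L (inv_into UNIV \<phi> \<circ> \<sigma> \<circ> \<phi>)"


section \<open>The group $C_2^4 \rtimes S_5$\<close>

definition semidirect_product ::
    "('a, 'm) monoid_scheme \<Rightarrow> ('b, 'n) monoid_scheme \<Rightarrow> ('b \<Rightarrow> 'a \<Rightarrow> 'a) \<Rightarrow> ('a \<times> 'b) monoid" where
  "semidirect_product N H \<theta> =
     \<lparr>carrier = carrier N \<times> carrier H,
      mult = \<lambda>(n, h) (n', h'). (n \<otimes>\<^bsub>N\<^esub> \<theta> h n', h \<otimes>\<^bsub>H\<^esub> h'),
      one = (\<one>\<^bsub>N\<^esub>, \<one>\<^bsub>H\<^esub>)\<rparr>"

definition additive_group :: "'a::ab_group_add monoid" where
  "additive_group = \<lparr>carrier = UNIV, mult = (+), one = 0\<rparr>"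

text \<open>
  $C_2^4$ is identified with the quotient of $F_2^5$ by the subgroup generated by $e_0 + ... + e_4$.
  The index type \<open>5\<close> has the elements \<open>0, \<dots>, 4\<close>, and \<open>e\<^sub>i\<close> is \<open>axis i 1\<close>.
\<close>

definition C2_pow_4 :: "(bit ^ 5) set monoid" where
  "C2_pow_4 = additive_group Mod (generate additive_group {\<Sum>i\<in>UNIV. axis i 1})"

definition S5 :: "(5 \<Rightarrow> 5) monoid" where
  "S5 = BijGroup UNIV"

text \<open>The linear map with \<open>e\<^sub>i \<mapsto> e\<^bsub>\<pi> i\<^esub>\<close>.\<close>

definition permute_coords :: "(5 \<Rightarrow> 5) \<Rightarrow> bit ^ 5 \<Rightarrow> bit ^ 5" where
  "permute_coords \<pi> x = (\<chi> i. x $ inv_into UNIV \<pi> i)"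

text \<open>\<open>S5\<close> acts on the quotient by mapping a coset to its image under \<^const>\<open>permute_coords\<close>.\<close>

definition C2_pow_4_semidirect_S5 :: "((bit ^ 5) set \<times> (5 \<Rightarrow> 5)) monoid" where
  "C2_pow_4_semidirect_S5 = semidirect_product C2_pow_4 S5 (\<lambda>\<pi> C. permute_coords \<pi> ` C)"

end

(*
  Let e_0 be the all-ones vector. If all faces of Q_4 have the same sum, then so do all 4-cycles
  v, v + e_i, v + e_i + e_j, v + e_j of FQ_4, where 0 <= i < j <= 4: the magic labelings of Q_4
  and FQ_4 coincide, and Aut(FQ_4) acts on them. The sum is 34. After a translation the label of
  0 is 16. The face conditions at 0 then give f(e_i + e_j) = 18 - f(e_i) - f(e_j), so f is
  determined by the five numbers f(e_i), and one more face condition says that they add up to 20.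
  The labels 1, 2, 3 must occur among them, because f(e_i + e_j) <= 3 would make
  f(e_i) + f(e_j) >= 15 and leave only 5 for three distinct positive numbers. The other two
  then add up to 14, and the only choice without a repeated label is {5, 9}. Hence any two
  labelings differ by a translation and a permutation of the e_i, i.e. by an automorphism of FQ_4,
  which is unique because labelings are injective.
*)
theory Submission
  imports Defs "HOL-Analysis.Cartesian_Space" "HOL-Combinatorics.Permutations"
begin

section \<open>The folded hypercube as a Cayley graph\<close>

lemma forall_5: "(\<forall>i::5. P i) \<longleftrightarrow> P 0 \<and> P 1 \<and> P 2 \<and> P 3 \<and> P 4"
proof (intro iffI allI)
  fix i :: 5 assume P: "P 0 \<and> P 1 \<and> P 2 \<and> P 3 \<and> P 4"
  show "P i"
  proof (cases i)
    case (of_int z)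
    then have "0 \<le> z" "z < 5" by simp_all
    then have "z = 0 \<or> z = 1 \<or> z = 2 \<or> z = 3 \<or> z = 4" by linarith
    then show ?thesis using of_int P by (elim disjE) simp_all
  qed
qed simp

lemma exists_5: "(\<exists>i::5. P i) \<longleftrightarrow> P 0 \<or> P 1 \<or> P 2 \<or> P 3 \<or> P 4"
proof -
  have "(\<exists>i. P i) \<longleftrightarrow> \<not> (\<forall>i. \<not> P i)" by simp
  then show ?thesis unfolding forall_5 by simp
qed

lemma UNIV_5: "(UNIV :: 5 set) = {0, 1, 2, 3, 4}"
proof -
  have "\<forall>i::5. i \<in> {0, 1, 2, 3, 4}" unfolding forall_5 by simp
  then show ?thesis by (simp add: set_eq_iff del: insert_iff)
qed

lemma exists_4: "(\<exists>i::4. P i) \<longleftrightarrow> P 1 \<or> P 2 \<or> P 3 \<or> P 4"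
proof -
  have "(\<exists>i. P i) \<longleftrightarrow> \<not> (\<forall>i. \<not> P i)" by simp
  then show ?thesis unfolding forall_4 by simp
qed

lemma forall_bit: "(\<forall>b::bit. P b) \<longleftrightarrow> P 0 \<and> P 1"
  by (metis bit.exhaust)

lemma bit_neq_iff: "a \<noteq> b \<longleftrightarrow> b = a + (1::bit)"
  by (cases a; cases b) simp_all

lemma add_self_bit_vec [simp]: "x + x = (0 :: bit ^ 'n)" "x + (x + y) = (y :: bit ^ 'n)"
  by (simp_all add: vec_eq_iff)

lemma uminus_bit_vec [simp]: "- x = (x :: bit ^ 'n)"
  by (simp add: vec_eq_iff)

definition vec4 :: "bit \<Rightarrow> bit \<Rightarrow> bit \<Rightarrow> bit \<Rightarrow> bit ^ 4" where
  "vec4 a b c d = (\<chi> i. if i = 1 then a else if i = 2 then b else if i = 3 then c else d)"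

lemma vec4_nth [simp]:
  "vec4 a b c d $ 1 = a" "vec4 a b c d $ 2 = b" "vec4 a b c d $ 3 = c" "vec4 a b c d $ 4 = d"
  by (simp_all add: vec4_def)

lemma vec4_eq_iff [simp]: "vec4 a b c d = vec4 a' b' c' d' \<longleftrightarrow> a = a' \<and> b = b' \<and> c = c' \<and> d = d'"
  by (auto simp: vec_eq_iff forall_4)

lemma vec4_add [simp]: "vec4 a b c d + vec4 a' b' c' d' = vec4 (a + a') (b + b') (c + c') (d + d')"
  by (simp add: vec_eq_iff forall_4 del: add_bit_eq_xor)

lemma vec4_eq_0_iff [simp]: "vec4 a b c d = 0 \<longleftrightarrow> a = 0 \<and> b = 0 \<and> c = 0 \<and> d = 0"
  by (auto simp: vec_eq_iff forall_4)

lemma vec4_eta: "vec4 (v $ 1) (v $ 2) (v $ 3) (v $ 4) = v"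
  by (simp add: vec_eq_iff forall_4)

text \<open>Together with \<open>forall_bit\<close> this splits a statement about all vertices into
  16 ground instances that simp can evaluate.\<close>

lemma forall_vec4: "(\<forall>v. P v) \<longleftrightarrow> (\<forall>a b c d. P (vec4 a b c d))"
proof (intro iffI allI)
  fix v :: "bit ^ 4" assume "\<forall>a b c d. P (vec4 a b c d)"
  then have "P (vec4 (v $ 1) (v $ 2) (v $ 3) (v $ 4))" by blast
  then show "P v" by (simp add: vec4_eta)
qed blast

text \<open>The quotient map of F_2^5 by the line through the all-ones vector: of the two
  representatives of a coset it reads off the one with coordinate 0 equal to 0.\<close>

definition proj :: "bit ^ 5 \<Rightarrow> bit ^ 4" where
  "proj x = vec4 (x $ 1 + x $ 0) (x $ 2 + x $ 0) (x $ 3 + x $ 0) (x $ 4 + x $ 0)"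

definition lift :: "bit ^ 4 \<Rightarrow> bit ^ 5" where
  "lift v = (\<chi> k. if k = 0 then 0 else if k = 1 then v $ 1 else if k = 2 then v $ 2
                  else if k = 3 then v $ 3 else v $ 4)"

lemma proj_add: "proj (x + y) = proj x + proj y"
  by (simp add: proj_def add_ac del: add_bit_eq_xor)

lemma proj_lift [simp]: "proj (lift v) = v"
  by (simp add: proj_def lift_def vec_eq_iff forall_4)

text \<open>Each component of \<open>proj x\<close> compares one coordinate with coordinate 0, so
  all of them vanish exactly when the five coordinates agree.\<close>

lemma proj_eq_0_iff: "proj x = 0 \<longleftrightarrow> x = 0 \<or> x = (\<chi> i. 1)"
  unfolding proj_def vec4_eq_0_iff unfolding vec_eq_iff forall_5
  by (cases "x $ 0"; cases "x $ 1"; cases "x $ 2"; cases "x $ 3"; cases "x $ 4") simp_all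

lemma proj_eq_iff: "proj x = proj y \<longleftrightarrow> x = y \<or> x = y + (\<chi> i. 1)"
proof -
  have "proj x = proj y \<longleftrightarrow> proj (x + y) = 0"
    unfolding proj_add add_eq_0_iff by auto
  also have "\<dots> \<longleftrightarrow> x = y \<or> x = y + (\<chi> i. 1)"
    unfolding proj_eq_0_iff by (metis add.commute add_0_right add_self_bit_vec)
  finally show ?thesis .
qed

lemma surj_proj: "surj proj"
  using proj_lift by (rule surjI)

text \<open>
  \<open>FQ\<^sub>4\<close> is the Cayley graph of \<open>F\<^sub>2\<^sup>4\<close> with five generators of sum \<open>0\<close>: the unit vectors \<open>gen 1, \<dots>, gen 4\<close>
  and the antipodal direction \<open>gen 0\<close>. In this form its symmetry under \<open>S\<^sub>5\<close> is visible.
\<close>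

definition gen :: "5 \<Rightarrow> bit ^ 4" where
  "gen k = proj (axis k 1)"

lemma gen_simps:
  "gen 0 = vec4 1 1 1 1" "gen 1 = vec4 1 0 0 0" "gen 2 = vec4 0 1 0 0" "gen 3 = vec4 0 0 1 0"
  "gen 4 = vec4 0 0 0 1"
  by (simp_all add: gen_def proj_def axis_def)

lemma gen_eq_iff [simp]: "gen i = gen j \<longleftrightarrow> i = j"
proof -
  have "\<forall>i j. gen i = gen j \<longrightarrow> i = j"
    unfolding forall_5 by (simp add: gen_simps)
  then show ?thesis by blast
qed

lemma gen_neq_0 [simp]: "gen i \<noteq> 0"
proof -
  have "\<forall>i. gen i \<noteq> 0"
    unfolding forall_5 by (simp add: gen_simps)
  then show ?thesis by blast
qed

lemma gen_add_gen_neq_gen: "gen i + gen j \<noteq> gen k"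
proof -
  have "\<forall>i j k. gen i + gen j \<noteq> gen k"
    unfolding forall_5 by (simp add: gen_simps)
  then show ?thesis by blast
qed

text \<open>The only relation among the five generators is that all of them sum to 0, so a relation
  with at most four terms is trivial. This finite check is done by enumeration.\<close>

lemma gen_add_eq_gen_add:
  assumes "gen i + gen j = gen k + gen l" "i \<noteq> j"
  shows "i = k \<and> j = l \<or> i = l \<and> j = k"
proof -
  have "\<forall>i j k l. gen i + gen j = gen k + gen l \<longrightarrow> i \<noteq> j \<longrightarrow> i = k \<and> j = l \<or> i = l \<and> j = k"
    unfolding forall_5 by (simp add: gen_simps)
  then show ?thesis using assms by blast
qed

text \<open>The ball of radius 2 around 0 is all of FQ_4, with 1 + 5 + 10 = 16 vertices.\<close>

lemma vertex_cases:
  obtains "v = 0" | i where "v = gen i" | i j where "i \<noteq> j" "v = gen i + gen j"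
proof -
  have "\<forall>v. v = 0 \<or> (\<exists>i. v = gen i) \<or> (\<exists>i j. i \<noteq> j \<and> v = gen i + gen j)"
    unfolding forall_vec4 forall_bit exists_5 by (simp add: gen_simps)
  then show ?thesis using that by blast
qed

text \<open>Differing in exactly one coordinate means adding a unit vector, and the unit vectors are
  the generators other than \<open>gen 0\<close>.\<close>

lemma hypercube_iff: "hypercube x y \<longleftrightarrow> (\<exists>k. k \<noteq> 0 \<and> y = x + gen k)"
proof -
  have "hypercube x y \<longleftrightarrow> (\<exists>i. {i. x $ i \<noteq> y $ i} = {i})"
    unfolding hypercube_def by (simp add: card_1_singleton_iff)
  also have "\<dots> \<longleftrightarrow> (\<exists>i. y = x + axis i 1)"
  proof (intro ex_cong1 iffI)
    fix i assume "{i. x $ i \<noteq> y $ i} = {i}"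
    then have *: "x $ j \<noteq> y $ j \<longleftrightarrow> j = i" for j by auto
    have "y $ j = x $ j + (if j = i then 1 else 0)" for j
      using *[of j] by (cases "j = i"; cases "x $ j"; cases "y $ j") simp_all
    then show "y = x + axis i 1"
      by (simp add: vec_eq_iff axis_def)
  next
    fix i assume "y = x + axis i 1"
    then show "{i. x $ i \<noteq> y $ i} = {i}" by (auto simp: axis_def split: if_splits)
  qed
  also have "\<dots> \<longleftrightarrow> (\<exists>k. k \<noteq> 0 \<and> y = x + gen k)"
  proof -
    have "axis 1 1 = gen 1" "axis 2 1 = gen 2" "axis 3 1 = gen 3" "axis 4 1 = gen 4"
      by (simp_all add: gen_simps vec_eq_iff forall_4 axis_def)
    then show ?thesis
      unfolding exists_4 exists_5 by simp
  qed
  finally show ?thesis .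
qed

lemma folded_hypercube_iff: "folded_hypercube x y \<longleftrightarrow> (\<exists>k. y = x + gen k)"
proof -
  have "card {i. x $ i \<noteq> y $ i} = 4 \<longleftrightarrow> {i. x $ i \<noteq> y $ i} = UNIV"
    using card_eq_UNIV_imp_eq_UNIV[of "{i. x $ i \<noteq> y $ i}"] by auto
  also have "\<dots> \<longleftrightarrow> (\<forall>i. x $ i \<noteq> y $ i)"
    by auto
  also have "\<dots> \<longleftrightarrow> y = x + gen 0"
    unfolding bit_neq_iff vec_eq_iff forall_4 by (simp add: gen_simps)
  finally show ?thesis
    unfolding folded_hypercube_def hypercube_iff exists_5 by auto
qed


section \<open>Magic labelings\<close>

lemma graph_iso_inv: "graph_iso E F \<phi> \<Longrightarrow> graph_iso F E (inv_into UNIV \<phi>)"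
  unfolding graph_iso_def by (metis bij_imp_bij_inv bij_inv_eq_iff)

lemma graph_iso_comp: "graph_iso E F \<phi> \<Longrightarrow> graph_iso F G \<psi> \<Longrightarrow> graph_iso E G (\<psi> \<circ> \<phi>)"
  unfolding graph_iso_def by (auto intro: bij_comp)

lemma four_cycle_graph_iso:
  "graph_iso E F \<phi> \<Longrightarrow> four_cycle F (\<phi> a) (\<phi> b) (\<phi> c) (\<phi> d) \<longleftrightarrow> four_cycle E a b c d"
  unfolding graph_iso_def four_cycle_def by (auto simp: bij_def inj_def)

text \<open>One condition for Q_4, FQ_4 and the torus alike. The common sum is left open; for these
  graphs it turns out to be 34.\<close>

definition magic_labelings :: "('a \<Rightarrow> 'a \<Rightarrow> bool) \<Rightarrow> ('a \<Rightarrow> nat) set" where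
  "magic_labelings E =
     {f. bij_betw f UNIV {1..16} \<and>
         (\<exists>s. \<forall>a b c d. four_cycle E a b c d \<longrightarrow> f a + f b + f c + f d = s)}"

lemma comp_magic_labelings:
  assumes "graph_iso E F \<phi>" "f \<in> magic_labelings F"
  shows "f \<circ> \<phi> \<in> magic_labelings E"
proof -
  have "bij_betw (f \<circ> \<phi>) UNIV {1..16}"
    using assms by (auto simp: graph_iso_def magic_labelings_def intro: bij_betw_trans)
  moreover obtain s where "\<And>a b c d. four_cycle F a b c d \<Longrightarrow> f a + f b + f c + f d = s"
    using assms by (auto simp: magic_labelings_def)
  then have "\<And>a b c d. four_cycle E a b c d \<Longrightarrow> f (\<phi> a) + f (\<phi> b) + f (\<phi> c) + f (\<phi> d) = s"
    using four_cycle_graph_iso[OF assms(1)] by blast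
  ultimately show ?thesis
    unfolding magic_labelings_def by auto
qed

lemma bij_betw_comp_magic_labelings:
  assumes "graph_iso E F \<phi>"
  shows "bij_betw (\<lambda>f. f \<circ> \<phi>) (magic_labelings F) (magic_labelings E)"
proof (rule bij_betw_byWitness[where f' = "\<lambda>f. f \<circ> inv_into UNIV \<phi>"])
  have "bij \<phi>" using assms by (simp add: graph_iso_def)
  then have *: "\<phi> \<circ> inv_into UNIV \<phi> = id" "inv_into UNIV \<phi> \<circ> \<phi> = id"
    by (simp_all add: bij_is_surj bij_is_inj flip: surj_iff)
  show "\<forall>f\<in>magic_labelings F. f \<circ> \<phi> \<circ> inv_into UNIV \<phi> = f" "\<forall>f\<in>magic_labelings E. f \<circ> inv_into UNIV \<phi> \<circ> \<phi> = f"
    by (simp_all add: comp_assoc *)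
qed (use comp_magic_labelings assms graph_iso_inv in \<open>blast+\<close>)

definition cayley :: "5 set \<Rightarrow> bit ^ 4 \<Rightarrow> bit ^ 4 \<Rightarrow> bool" where
  "cayley K x y \<longleftrightarrow> (\<exists>k\<in>K. y = x + gen k)"

lemma hypercube_eq_cayley: "hypercube = cayley (- {0})"
  by (auto simp: fun_eq_iff hypercube_iff cayley_def)

lemma folded_hypercube_eq_cayley: "folded_hypercube = cayley UNIV"
  by (auto simp: fun_eq_iff folded_hypercube_iff cayley_def)

text \<open>The four directions of a closed walk sum to 0. Distinctness of the vertices makes
  consecutive steps differ, so by \<open>gen_add_eq_gen_add\<close> opposite steps have the same
  direction.\<close>

lemma four_cycle_cayley_iff:
  "four_cycle (cayley K) a b c d \<longleftrightarrow>
     (\<exists>i\<in>K. \<exists>j\<in>K. i \<noteq> j \<and> b = a + gen i \<and> c = a + gen i + gen j \<and> d = a + gen j)"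
proof
  assume "four_cycle (cayley K) a b c d"
  then obtain i k l j where K: "i \<in> K" "k \<in> K" "l \<in> K" "j \<in> K"
    and b: "b = a + gen i" and c: "c = b + gen k" and d: "d = c + gen l" and a: "a = d + gen j"
    and dist: "distinct [a, b, c, d]"
    unfolding four_cycle_def cayley_def by blast
  have d': "d = a + gen j"
    using a by (metis add.commute add_self_bit_vec(2))
  have "i \<noteq> k" "i \<noteq> j"
    using dist b c d' by (auto simp: add.assoc)
  \<comment> \<open>Both sides are \<open>c\<close>, reached from \<open>a\<close> through
    \<open>b\<close> and through \<open>d\<close>.\<close>
  moreover have "a + (gen i + gen k) = a + (gen j + gen l)"
    using b c d d' by (metis add.assoc add.commute add_self_bit_vec(2))
  ultimately have "k = j"
    using gen_add_eq_gen_add[of i k j l] by auto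
  then show "\<exists>i\<in>K. \<exists>j\<in>K. i \<noteq> j \<and> b = a + gen i \<and> c = a + gen i + gen j \<and> d = a + gen j"
    using K b c d' \<open>i \<noteq> j\<close> by blast
next
  assume "\<exists>i\<in>K. \<exists>j\<in>K. i \<noteq> j \<and> b = a + gen i \<and> c = a + gen i + gen j \<and> d = a + gen j"
  then obtain i j where *: "i \<in> K" "j \<in> K" "i \<noteq> j" "b = a + gen i" "c = a + gen i + gen j" "d = a + gen j"
    by blast
  have "gen i + gen j \<noteq> 0"
    using \<open>i \<noteq> j\<close> by (metis add_eq_0_iff uminus_bit_vec gen_eq_iff)
  then have "distinct [a, b, c, d]"
    using * by (auto simp: add.assoc)
  moreover have "c = b + gen j" "d = c + gen i" "a = d + gen j"
    using * by (simp_all add: add_ac)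
  ultimately show "four_cycle (cayley K) a b c d"
    unfolding four_cycle_def cayley_def using * by blast
qed

definition face_sum :: "(bit ^ 4 \<Rightarrow> nat) \<Rightarrow> bit ^ 4 \<Rightarrow> 5 \<Rightarrow> 5 \<Rightarrow> nat" where
  "face_sum f v i j = f v + f (v + gen i) + f (v + gen i + gen j) + f (v + gen j)"

lemma face_sum_commute: "face_sum f v i j = face_sum f v j i"
  by (simp add: face_sum_def add_ac)

lemma magic_labelings_cayley_iff:
  "f \<in> magic_labelings (cayley K) \<longleftrightarrow>
     bij_betw f UNIV {1..16} \<and> (\<exists>s. \<forall>v. \<forall>i\<in>K. \<forall>j\<in>K. i \<noteq> j \<longrightarrow> face_sum f v i j = s)"
proof -
  have "(\<forall>a b c d. four_cycle (cayley K) a b c d \<longrightarrow> f a + f b + f c + f d = s) \<longleftrightarrow>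
      (\<forall>v. \<forall>i\<in>K. \<forall>j\<in>K. i \<noteq> j \<longrightarrow> face_sum f v i j = s)" (is "?L \<longleftrightarrow> ?R") for s
  proof
    assume L: ?L
    show ?R
    proof (intro allI ballI impI)
      fix v i j assume "i \<in> K" "j \<in> K" "i \<noteq> j"
      then have "four_cycle (cayley K) v (v + gen i) (v + gen i + gen j) (v + gen j)"
        unfolding four_cycle_cayley_iff by blast
      then show "face_sum f v i j = s"
        using L unfolding face_sum_def by blast
    qed
  next
    assume ?R
    then show ?L
      unfolding face_sum_def four_cycle_cayley_iff by blast
  qed
  then show ?thesis
    unfolding magic_labelings_def by simp
qed

text \<open>\<open>gen 0\<close> is the sum of the four unit vectors; adding \<open>gen i\<close>
  cancels one of them and leaves the other three.\<close>

lemma sum_gen_4: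
  assumes "i \<noteq> 0"
  obtains k l m where "k \<notin> {0, i}" "l \<notin> {0, i}" "m \<notin> {0, i}"
    "gen k + gen l + gen m = gen 0 + gen i"
proof -
  have "\<forall>i. i \<noteq> 0 \<longrightarrow> (\<exists>k l m. k \<notin> {0, i} \<and> l \<notin> {0, i} \<and> m \<notin> {0, i} \<and>
    gen k + gen l + gen m = gen 0 + gen i)"
    unfolding forall_5 exists_5 by (simp add: gen_simps)
  then show ?thesis using that assms by blast
qed

text \<open>
  Moving an edge in direction \<open>i\<close> along one further coordinate replaces the sum \<open>x\<close> of its labels
  by \<open>s - x\<close>; moving it along the three remaining coordinates reaches the antipodal edge.
\<close>

lemma face_sum_antipodal:
  assumes s: "\<And>v i j. i \<noteq> 0 \<Longrightarrow> j \<noteq> 0 \<Longrightarrow> i \<noteq> j \<Longrightarrow> face_sum f v i j = s" and "i \<noteq> 0"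
  shows "face_sum f v i 0 = s"
proof -
  obtain k l m where klm: "k \<notin> {0, i}" "l \<notin> {0, i}" "m \<notin> {0, i}"
    "gen k + gen l + gen m = gen 0 + gen i"
    using sum_gen_4[OF \<open>i \<noteq> 0\<close>] by metis
  define F where "F w = f w + f (w + gen i)" for w
  have step: "F w + F (w + gen k) = s" if "k \<notin> {0, i}" for k w
    using s[of i k w] that \<open>i \<noteq> 0\<close> by (auto simp: face_sum_def F_def add_ac)
  \<comment> \<open>Three is odd, so the last edge sum is again \<open>s\<close> minus the first
    one.\<close>
  have "F v + F (v + gen k) = s" "F (v + gen k) + F (v + gen k + gen l) = s"
    "F (v + gen k + gen l) + F (v + gen k + gen l + gen m) = s"
    using klm by (simp_all add: step)
  then have "F v + F (v + (gen k + gen l + gen m)) = s"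
    by (simp add: add_ac)
  \<comment> \<open>The edge reached has the ends \<open>v + gen 0 + gen i\<close> and
    \<open>v + gen 0\<close>, the two remaining corners of the folded face.\<close>
  moreover have "v + (gen 0 + gen i) + gen i = v + gen 0"
    by (metis add.assoc add.commute add_self_bit_vec(2))
  ultimately show ?thesis
    unfolding klm F_def face_sum_def by (simp add: add_ac)
qed

section \<open>The magic constant\<close>

lemma bij_add_bit_vec: "bij (\<lambda>v. v + g :: bit ^ 4)"
  by (rule bij_betw_byWitness[where f' = "\<lambda>v. v + g"]) (simp_all add: add.assoc)

lemma UNIV_bit: "(UNIV :: bit set) = {0, 1}"
  using bit.exhaust by auto

lemma CARD_bit: "CARD(bit) = 2"
  by (simp add: UNIV_bit)

lemma sum_labels: "bij_betw f UNIV {1..16::nat} \<Longrightarrow> sum f UNIV = 136"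
  using sum.reindex_bij_betw[of f UNIV "{1..16}" "\<lambda>x. x"] by (simp add: numeral_eq_Suc)

text \<open>With the directions fixed, summing over all 16 base points counts every label four
  times, so 16 \<open>s\<close> = 4 * 136.\<close>

lemma face_sum_eq_34:
  assumes "bij_betw f UNIV {1..16}" and s: "\<And>v. face_sum f v i j = s"
  shows "s = 34"
proof -
  have shift: "(\<Sum>v\<in>UNIV. f (v + g)) = sum f UNIV" for g
    using sum.reindex_bij_betw[OF bij_add_bit_vec[of g], of f] by simp
  have "16 * s = (\<Sum>v\<in>UNIV. face_sum f v i j)"
    unfolding s by (simp add: CARD_bit)
  also have "\<dots> = 4 * sum f UNIV"
    unfolding face_sum_def add.assoc sum.distrib shift by simp
  finally show ?thesis
    using sum_labels[OF assms(1)] by simp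
qed

lemma magic_labelings_folded_hypercube_iff:
  "f \<in> magic_labelings folded_hypercube \<longleftrightarrow>
     bij_betw f UNIV {1..16} \<and> (\<forall>v i j. i \<noteq> j \<longrightarrow> face_sum f v i j = 34)"
  unfolding folded_hypercube_eq_cayley magic_labelings_cayley_iff
  \<comment> \<open>One pair of distinct directions already fixes the sum; 0 and 1 are an arbitrary
    choice.\<close>
  using face_sum_eq_34[of f 0 1] by auto

lemma magic_labelings_hypercube: "magic_labelings hypercube = magic_labelings folded_hypercube"
proof (rule subset_antisym; rule subsetI)
  fix f assume "f \<in> magic_labelings hypercube"
  then obtain s where bij: "bij_betw f UNIV {1..16}"
    and s: "\<And>v i j. i \<noteq> 0 \<Longrightarrow> j \<noteq> 0 \<Longrightarrow> i \<noteq> j \<Longrightarrow> face_sum f v i j = s"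
    unfolding hypercube_eq_cayley magic_labelings_cayley_iff by auto
  have "face_sum f v i j = s" if "i \<noteq> j" for v i j
    using that s face_sum_antipodal[of f s] face_sum_commute[of f v] by metis
  then show "f \<in> magic_labelings folded_hypercube"
    unfolding folded_hypercube_eq_cayley magic_labelings_cayley_iff using bij by blast
next
  fix f assume "f \<in> magic_labelings folded_hypercube"
  then show "f \<in> magic_labelings hypercube"
    unfolding hypercube_eq_cayley folded_hypercube_eq_cayley magic_labelings_cayley_iff by blast
qed


section \<open>Automorphisms of the folded hypercube\<close>

lemma permute_coords_add: "permute_coords \<pi> (x + y) = permute_coords \<pi> x + permute_coords \<pi> y"
  by (simp add: permute_coords_def vec_eq_iff)

lemma permute_coords_axis:
  assumes "bij \<pi>"
  shows "permute_coords \<pi> (axis k 1) = axis (\<pi> k) 1"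
proof -
  have "inv_into UNIV \<pi> i = k \<longleftrightarrow> i = \<pi> k" for i
    using bij_inv_eq_iff[OF assms] by metis
  then show ?thesis
    by (simp add: permute_coords_def vec_eq_iff axis_def)
qed

lemma permute_coords_comp:
  assumes "bij \<pi>" "bij \<rho>"
  shows "permute_coords \<pi> (permute_coords \<rho> x) = permute_coords (\<pi> \<circ> \<rho>) x"
  using assms by (simp add: permute_coords_def vec_eq_iff o_inv_distrib)

lemma permute_coords_id: "permute_coords id x = x"
  by (simp add: permute_coords_def vec_eq_iff)

definition lin :: "(5 \<Rightarrow> 5) \<Rightarrow> bit ^ 4 \<Rightarrow> bit ^ 4" where
  "lin \<pi> v = proj (permute_coords \<pi> (lift v))"

text \<open>Coordinate permutations fix the all-ones vector, which spans the kernel of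
  \<open>proj\<close>. Hence they descend to the quotient, and the choice of representative made by
  \<open>lift\<close> does not matter.\<close>

lemma lin_proj: "lin \<pi> (proj x) = proj (permute_coords \<pi> x)"
proof -
  have "lift (proj x) = x \<or> lift (proj x) = x + (\<chi> i. 1)"
    by (simp flip: proj_eq_iff)
  moreover have "permute_coords \<pi> (\<chi> i. 1) = (\<chi> i. 1)"
    by (simp add: permute_coords_def)
  ultimately show ?thesis
    unfolding lin_def proj_eq_iff by (auto simp: permute_coords_add)
qed

lemma lin_add: "lin \<pi> (v + w) = lin \<pi> v + lin \<pi> w"
  by (metis lin_proj proj_lift proj_add permute_coords_add)

lemma lin_0 [simp]: "lin \<pi> 0 = 0"
  by (metis add_self_bit_vec(1) lin_add)

lemma lin_gen [simp]: "bij \<pi> \<Longrightarrow> lin \<pi> (gen k) = gen (\<pi> k)"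
  by (simp add: gen_def lin_proj permute_coords_axis)

lemma lin_lin: "bij \<pi> \<Longrightarrow> bij \<rho> \<Longrightarrow> lin \<pi> (lin \<rho> v) = lin (\<pi> \<circ> \<rho>) v"
  by (metis lin_proj proj_lift permute_coords_comp)

lemma lin_id [simp]: "lin id v = v"
  by (simp add: lin_def permute_coords_id)

definition aff :: "bit ^ 4 \<Rightarrow> (5 \<Rightarrow> 5) \<Rightarrow> bit ^ 4 \<Rightarrow> bit ^ 4" where
  "aff c \<pi> v = c + lin \<pi> v"

lemma aff_comp: "bij \<pi> \<Longrightarrow> bij \<rho> \<Longrightarrow> aff c \<pi> \<circ> aff d \<rho> = aff (c + lin \<pi> d) (\<pi> \<circ> \<rho>)"
  by (simp add: aff_def fun_eq_iff lin_add lin_lin add_ac)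

lemma bij_aff:
  assumes "bij \<pi>"
  shows "bij (aff c \<pi>)"
proof -
  define \<rho> where "\<rho> = inv_into UNIV \<pi>"
  have \<rho>: "bij \<rho>" "\<pi> \<circ> \<rho> = id" "\<rho> \<circ> \<pi> = id"
    using assms by (auto simp: \<rho>_def bij_imp_bij_inv bij_is_inj fun_eq_iff bij_is_surj surj_f_inv_f)
  \<comment> \<open>Solving \<open>w = c + lin \<pi> v\<close> gives
    \<open>v = lin \<rho> c + lin \<rho> w\<close>, since subtraction is addition here.\<close>
  have "aff c \<pi> \<circ> aff (lin \<rho> c) \<rho> = id" "aff (lin \<rho> c) \<rho> \<circ> aff c \<pi> = id"
    using assms \<rho> by (simp_all add: aff_comp lin_lin) (simp_all add: aff_def fun_eq_iff)
  then show ?thesis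
    using o_bij by blast
qed

lemma graph_iso_aff:
  assumes "bij \<pi>"
  shows "graph_iso folded_hypercube folded_hypercube (aff c \<pi>)"
proof -
  have "folded_hypercube x y \<longleftrightarrow> folded_hypercube (aff c \<pi> x) (aff c \<pi> y)" for x y
  proof -
    have "y = x + gen k \<longleftrightarrow> aff c \<pi> y = aff c \<pi> x + gen (\<pi> k)" for k
    proof -
      have "aff c \<pi> x + gen (\<pi> k) = aff c \<pi> (x + gen k)"
        using assms by (simp add: aff_def lin_add add.assoc)
      then show ?thesis
        using bij_aff[OF assms] by (metis bij_def inj_eq)
    qed
    then show ?thesis
      unfolding folded_hypercube_iff using assms by (metis bij_pointE)
  qed
  then show ?thesis
    using bij_aff[OF assms] by (simp add: graph_iso_def)
qed

text \<open>
  An automorphism is determined by its values on \<open>0\<close> and the neighbours \<open>gen i\<close> of \<open>0\<close>, because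
  \<open>gen i + gen j\<close> is the only common neighbour of \<open>gen i\<close> and \<open>gen j\<close> other than \<open>0\<close>.
\<close>

lemma graph_iso_folded_hypercube_obtain:
  assumes "graph_iso folded_hypercube folded_hypercube \<sigma>"
  obtains \<pi> where "bij \<pi>" "\<sigma> = aff (\<sigma> 0) \<pi>"
proof -
  have inj: "\<sigma> x = \<sigma> y \<longleftrightarrow> x = y" for x y
    using assms by (auto simp: graph_iso_def bij_def inj_eq)
  have adj: "folded_hypercube (\<sigma> x) (\<sigma> y) \<longleftrightarrow> folded_hypercube x y" for x y
    using assms by (simp add: graph_iso_def)
  have nb: "\<exists>l. \<sigma> (v + gen k) = \<sigma> v + gen l" for v k
    using adj[of v "v + gen k"] unfolding folded_hypercube_iff by blast
  then have "\<forall>k. \<exists>l. \<sigma> (gen k) = \<sigma> 0 + gen l"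
    by (metis add_0)
  then obtain \<pi> where \<pi>: "\<And>k. \<sigma> (gen k) = \<sigma> 0 + gen (\<pi> k)"
    by metis
  have "inj \<pi>"
    by (rule injI) (metis \<pi> gen_eq_iff inj)
  then have bij: "bij \<pi>"
    by (simp add: bij_def finite_UNIV_inj_surj)
  have "\<sigma> v = \<sigma> 0 + lin \<pi> v" for v
  proof (cases v rule: vertex_cases)
    case (3 i j)
    obtain k where k: "\<sigma> (gen i + gen j) = \<sigma> 0 + gen (\<pi> i) + gen k"
      using nb[of "gen i" j] \<pi> by auto
    obtain l where l: "\<sigma> (gen i + gen j) = \<sigma> 0 + gen (\<pi> j) + gen l"
      using nb[of "gen j" i] \<pi> by (auto simp: add.commute)
    have "gen i + gen j \<noteq> 0"
      using 3 by (metis add_eq_0_iff uminus_bit_vec gen_eq_iff)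
    \<comment> \<open>With \<open>k = \<pi> i\<close> the image would be \<open>\<sigma> 0\<close>,
      against injectivity.\<close>
    then have "\<pi> i \<noteq> k"
      using k inj[of "gen i + gen j" 0] by (auto simp: add.assoc)
    moreover have "gen (\<pi> i) + gen k = gen (\<pi> j) + gen l"
      using k l by (simp add: add.assoc)
    ultimately have "k = \<pi> j"
      using gen_add_eq_gen_add \<open>inj \<pi>\<close> 3 by (metis injD)
    then show ?thesis
      using k 3 bij by (simp add: lin_add add.assoc)
  qed (use \<pi> bij in simp_all)
  then have "\<sigma> = aff (\<sigma> 0) \<pi>"
    unfolding fun_eq_iff aff_def by blast
  then show ?thesis
    using that bij by blast
qed

text \<open>The value at 0 recovers the translation and the values at the generators recover the
  permutation. Thus the 16 * 5! pairs give distinct automorphisms.\<close>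

lemma aff_eq_iff:
  assumes "bij \<pi>" "bij \<rho>"
  shows "aff c \<pi> = aff d \<rho> \<longleftrightarrow> c = d \<and> \<pi> = \<rho>"
proof
  assume eq: "aff c \<pi> = aff d \<rho>"
  have cd: "c = d"
    using fun_cong[OF eq, of 0] by (simp add: aff_def)
  have "\<pi> k = \<rho> k" for k
    using fun_cong[OF eq, of "gen k"] assms cd by (simp add: aff_def)
  then have "\<pi> = \<rho>" by auto
  with cd show "c = d \<and> \<pi> = \<rho>" by simp
qed simp

lemma graph_iso_folded_hypercube_eq:
  "{\<sigma>. graph_iso folded_hypercube folded_hypercube \<sigma>} = (\<lambda>(c, \<pi>). aff c \<pi>) ` (UNIV \<times> {\<pi>. bij \<pi>})"
proof (rule subset_antisym; rule subsetI)
  fix \<sigma> assume "\<sigma> \<in> {\<sigma>. graph_iso folded_hypercube folded_hypercube \<sigma>}"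
  then obtain \<pi> where "bij \<pi>" "\<sigma> = aff (\<sigma> 0) \<pi>"
    using graph_iso_folded_hypercube_obtain by blast
  then show "\<sigma> \<in> (\<lambda>(c, \<pi>). aff c \<pi>) ` (UNIV \<times> {\<pi>. bij \<pi>})"
    by (intro image_eqI[of _ _ "(\<sigma> 0, \<pi>)"]) simp_all
qed (auto intro: graph_iso_aff)

lemma card_bij_5: "card {\<pi> :: 5 \<Rightarrow> 5. bij \<pi>} = fact 5"
proof -
  have "bij \<pi> \<longleftrightarrow> \<pi> permutes UNIV" for \<pi> :: "5 \<Rightarrow> 5"
    using permutes_bij bij_imp_permutes by blast
  then show ?thesis
    using card_permutations[of "UNIV :: 5 set" 5] by simp
qed

lemma card_graph_iso_folded_hypercube:
  "card {\<sigma>. graph_iso folded_hypercube folded_hypercube \<sigma>} = 1920"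
proof -
  have "inj_on (\<lambda>(c, \<pi>). aff c \<pi>) (UNIV \<times> {\<pi>. bij \<pi>})"
    by (auto simp: inj_on_def aff_eq_iff)
  then show ?thesis
    unfolding graph_iso_folded_hypercube_eq
    by (simp add: card_image card_cartesian_product card_bij_5 CARD_bit fact_numeral)
qed


section \<open>Uniqueness of the magic labeling\<close>

text \<open>
  A magic labeling is an affine function of the five signs \<open>\<epsilon>\<close>, \<open>\<epsilon> (-1)\<^sup>v\<^sup>i\<close>, where \<open>\<epsilon>\<close> is the parity sign
  of \<open>v\<close>. The coefficients \<open>0, 1/2, 1, 2, 4\<close> give the binary expansion below.
\<close>

definition std_labeling :: "bit ^ 4 \<Rightarrow> nat" where
  "std_labeling v =
     (let p = v $ 1 + v $ 2 + v $ 3 + v $ 4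
      in 16 - (of_bool (v $ 1 + p = 1) + 2 * of_bool (v $ 2 + p = 1) +
               4 * of_bool (v $ 3 + p = 1) + 8 * of_bool (v $ 4 + p = 1)))"

text \<open>These six values determine the labeling: by \<open>magic_labeling_gen_add_gen\<close>
  the label of \<open>gen i + gen j\<close> is 18 minus those of \<open>gen i\<close> and
  \<open>gen j\<close>.\<close>

lemma std_labeling_simps:
  "std_labeling 0 = 16" "std_labeling (gen 0) = 1" "std_labeling (gen 1) = 2"
  "std_labeling (gen 2) = 3" "std_labeling (gen 3) = 5" "std_labeling (gen 4) = 9"
  by (simp_all add: std_labeling_def gen_simps)

lemma std_labeling_magic: "std_labeling \<in> magic_labelings folded_hypercube"
proof -
  have "\<forall>v w. std_labeling v = std_labeling w \<longrightarrow> v = w"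
    unfolding forall_vec4 forall_bit by (simp add: std_labeling_def)
  then have inj: "inj std_labeling"
    by (auto simp: inj_def)
  have "\<forall>v. std_labeling v \<in> {1..16}"
    unfolding forall_vec4 forall_bit by (simp add: std_labeling_def)
  then have "std_labeling ` UNIV = {1..16}"
    using inj by (intro card_subset_eq) (auto simp: card_image CARD_bit)
  then have bij: "bij_betw std_labeling UNIV {1..16}"
    using inj by (simp add: bij_betw_def)
  have "\<forall>v i j. i \<noteq> j \<longrightarrow> face_sum std_labeling v i j = 34"
    unfolding forall_vec4 forall_bit forall_5
    by (simp add: face_sum_def std_labeling_def gen_simps)
  then show ?thesis
    using bij by (simp add: magic_labelings_folded_hypercube_iff)
qed

section \<open>Reconstruction of a labeling from the neighbours of 0\<close>

lemma magic_labeling_gen_add_gen: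
  assumes "f \<in> magic_labelings folded_hypercube" "f 0 = 16" "i \<noteq> j"
  shows "f (gen i + gen j) + f (gen i) + f (gen j) = 18"
proof -
  have "face_sum f 0 i j = 34"
    using assms by (simp add: magic_labelings_folded_hypercube_iff)
  then show ?thesis
    using assms(2) by (simp add: face_sum_def)
qed

text \<open>Since the generators sum to 0, the face at \<open>gen 0\<close> in directions 1 and 2
  has \<open>gen 3 + gen 4\<close> as its opposite corner. Replacing its three pair labels by
  \<open>magic_labeling_gen_add_gen\<close> turns the face sum into 54 minus the sum sought.\<close>

lemma magic_labeling_sum_gen:
  assumes f: "f \<in> magic_labelings folded_hypercube" "f 0 = 16"
  shows "(\<Sum>i\<in>UNIV. f (gen i)) = 20"
proof -
  have "face_sum f (gen 0) 1 2 = 34"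
    using f by (simp add: magic_labelings_folded_hypercube_iff)
  moreover have "gen 0 + gen 1 + gen 2 = gen 3 + gen 4"
    by (simp add: gen_simps)
  ultimately have "f (gen 0) + f (gen 0 + gen 1) + f (gen 3 + gen 4) + f (gen 0 + gen 2) = 34"
    by (simp add: face_sum_def)
  then have "f (gen 0) + f (gen 1) + f (gen 2) + f (gen 3) + f (gen 4) = 20"
    using magic_labeling_gen_add_gen[OF f, of 0 1] magic_labeling_gen_add_gen[OF f, of 0 2]
      magic_labeling_gen_add_gen[OF f, of 3 4] by simp
  then show ?thesis
    unfolding UNIV_5 by simp
qed

lemma obtain_remaining_two:
  fixes i1 i2 i3 :: 5
  assumes "distinct [i1, i2, i3]"
  obtains i4 i5 where "distinct [i1, i2, i3, i4, i5]" "UNIV = {i1, i2, i3, i4, i5}"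
proof -
  have "card (UNIV - {i1, i2, i3}) = 2"
    using assms by (subst card_Diff_subset) auto
  then obtain i4 i5 where "UNIV - {i1, i2, i3} = {i4, i5}" "i4 \<noteq> i5"
    by (meson card_2_iff)
  then have "distinct [i1, i2, i3, i4, i5]" "UNIV = {i1, i2, i3, i4, i5}"
    using assms by auto
  then show ?thesis using that by blast
qed

lemma obtain_bij_5:
  fixes i1 :: 5
  assumes "UNIV = {i1, i2, i3, i4, i5}"
  obtains \<pi> :: "5 \<Rightarrow> 5" where "bij \<pi>" "\<pi> 0 = i1" "\<pi> 1 = i2" "\<pi> 2 = i3" "\<pi> 3 = i4" "\<pi> 4 = i5"
proof -
  define \<pi> :: "5 \<Rightarrow> 5" where "\<pi> k =
    (if k = 0 then i1 else if k = 1 then i2 else if k = 2 then i3 else if k = 3 then i4 else i5)" for k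
  have \<pi>: "\<pi> 0 = i1" "\<pi> 1 = i2" "\<pi> 2 = i3" "\<pi> 3 = i4" "\<pi> 4 = i5"
    by (simp_all add: \<pi>_def)
  then have "\<pi> ` {0, 1, 2, 3, 4} = {i1, i2, i3, i4, i5}"
    by simp
  then have "range \<pi> = UNIV"
    unfolding UNIV_5[symmetric] assms[symmetric] .
  then have "bij \<pi>"
    by (simp add: bij_def finite_UNIV_surj_inj)
  then show ?thesis using that \<pi> by blast
qed

text \<open>Bijectivity and the face sums force the labels 1, 2, 3, 5, 9 on the neighbours of 0; the
  permutation arranges them in the order used by \<open>std_labeling\<close>.\<close>

lemma magic_labeling_obtain_perm:
  assumes f: "f \<in> magic_labelings folded_hypercube" "f 0 = 16"
  obtains \<pi> where "bij \<pi>" "\<And>k. f (gen (\<pi> k)) = std_labeling (gen k)"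
proof -
  define a where "a i = f (gen i)" for i
  have bij: "bij_betw f UNIV {1..16}"
    using f by (simp add: magic_labelings_folded_hypercube_iff)
  have f_eq: "f v = f w \<longleftrightarrow> v = w" for v w
    using bij by (simp add: bij_betw_def inj_eq)
  have a_eq: "a i = a j \<longleftrightarrow> i = j" for i j
    by (simp add: a_def f_eq)
  have pos: "a i \<ge> 1" for i
    using bij_betwE[OF bij] by (auto simp: a_def)
  have pair: "f (gen i + gen j) + a i + a j = 18" if "i \<noteq> j" for i j
    using magic_labeling_gen_add_gen[OF f that] by (simp add: a_def)
  \<comment> \<open>Otherwise \<open>gen k\<close> and the different vertex
    \<open>gen i + gen j\<close> would share a label.\<close>
  have not_pair: "a k + a i + a j \<noteq> 18" if "i \<noteq> j" for i j k
    using pair[OF that] f_eq[of "gen i + gen j" "gen k"] gen_add_gen_neq_gen[of i j k]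
    by (auto simp: a_def)
  have sum: "sum a UNIV = 20"
    using magic_labeling_sum_gen[OF f] by (simp add: a_def)
  have small: "\<exists>i. a i = n" if "1 \<le> n" "n \<le> 3" for n
  proof -
    have "n \<in> range f"
      using bij that by (simp add: bij_betw_def)
    then obtain v where v: "f v = n" by blast
    show ?thesis
    proof (cases v rule: vertex_cases)
      case 1
      then show ?thesis using v f(2) that by simp
    next
      case (2 i)
      then show ?thesis using v by (auto simp: a_def)
    next
      case (3 i j)
      have "card (UNIV - {i, j}) = 3"
        using 3 by (subst card_Diff_subset) auto
      then obtain k l m where klm: "UNIV - {i, j} = {k, l, m}" "k \<noteq> l" "l \<noteq> m" "k \<noteq> m"
        by (metis card_3_iff)
      have "sum a UNIV = sum a {i, j} + sum a (UNIV - {i, j})"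
        by (rule sum.subset_diff[of "{i, j}" UNIV a, simplified add.commute]) auto
      also have "\<dots> = a i + a j + (a k + a l + a m)"
        unfolding klm(1) using 3 klm by simp
      finally have "a i + a j + (a k + a l + a m) = 20"
        using sum by simp
      moreover have "a i + a j \<ge> 15"
        using pair[OF 3(1)] 3(2) v that by simp
      moreover have "a k \<noteq> a l" "a l \<noteq> a m" "a k \<noteq> a m"
        using klm by (simp_all add: a_eq)
      ultimately have False
        using pos[of k] pos[of l] pos[of m] by linarith
      then show ?thesis ..
    qed
  qed
  obtain i1 i2 i3 where a123: "a i1 = 1" "a i2 = 2" "a i3 = 3"
    using small[of 1] small[of 2] small[of 3] by auto
  then have "distinct [i1, i2, i3]"
    by auto
  then obtain j4 j5 where j: "distinct [i1, i2, i3, j4, j5]" "UNIV = {i1, i2, i3, j4, j5}"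
    using obtain_remaining_two by metis
  \<comment> \<open>The last two indices are swapped if necessary, so that the labels 5 and 9 can
    occur in one order only.\<close>
  obtain i4 i5 where i: "distinct [i1, i2, i3, i4, i5]" "UNIV = {i1, i2, i3, i4, i5}" "a i4 < a i5"
  proof (cases "a j4 < a j5")
    case True
    then show ?thesis using that j by blast
  next
    case False
    moreover have "a j4 \<noteq> a j5"
      using j(1) by (simp add: a_eq)
    ultimately have "a j5 < a j4"
      by simp
    moreover have "distinct [i1, i2, i3, j5, j4]"
      using j(1) by auto
    moreover have "UNIV = {i1, i2, i3, j5, j4}"
      using j(2) by blast
    ultimately show ?thesis
      using that by blast
  qed
  have "sum a {i1, i2, i3, i4, i5} = 20"
    using sum unfolding i(2) .
  then have "a i4 + a i5 = 14"
    using i(1) a123 by simp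
  moreover have "a i4 \<noteq> 1" "a i4 \<noteq> 2" "a i4 \<noteq> 3"
    using i(1) a_eq a123 by (metis distinct_length_2_or_more)+
  \<comment> \<open>The pair 4, 10 fails: \<open>gen i4 + gen i5\<close> would carry 18 - 14 = 4 as
    well.\<close>
  moreover have "a i4 \<noteq> 4"
    using not_pair[of i4 i5 i4] i(1) \<open>a i4 + a i5 = 14\<close> by auto
  \<comment> \<open>The pair 6, 8 fails: \<open>gen i2 + gen i5\<close> would carry 18 - 2 - 8 = 8
    as well.\<close>
  moreover have "a i5 \<noteq> 8"
    using not_pair[of i2 i5 i5] i(1) a123 by auto
  ultimately have a45: "a i4 = 5" "a i5 = 9"
    using i(3) pos[of i4] by linarith+
  obtain \<pi> :: "5 \<Rightarrow> 5" where \<pi>: "bij \<pi>" "\<pi> 0 = i1" "\<pi> 1 = i2" "\<pi> 2 = i3" "\<pi> 3 = i4" "\<pi> 4 = i5"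
    using obtain_bij_5[OF i(2)] by metis
  have "\<forall>k. a (\<pi> k) = std_labeling (gen k)"
    unfolding forall_5 using a123 a45 \<pi> by (simp add: std_labeling_simps)
  then show ?thesis
    using that \<pi>(1) by (simp add: a_def)
qed

text \<open>A translation puts the label 16 at 0 and a permutation matches the labels of the
  generators. The remaining vertices then agree because both labelings obey
  \<open>magic_labeling_gen_add_gen\<close>.\<close>

lemma magic_labeling_eq_std:
  assumes f: "f \<in> magic_labelings folded_hypercube"
  obtains \<sigma> where "graph_iso folded_hypercube folded_hypercube \<sigma>" "f \<circ> \<sigma> = std_labeling"
proof -
  have "bij_betw f UNIV {1..16}"
    using f by (simp add: magic_labelings_folded_hypercube_iff)
  then have "16 \<in> range f"
    by (simp add: bij_betw_def)
  then obtain c where c: "f c = 16"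
    by (metis imageE)
  define g where "g = f \<circ> aff c id"
  have g: "g \<in> magic_labelings folded_hypercube" "g 0 = 16"
    using comp_magic_labelings[OF graph_iso_aff f] c by (simp_all add: g_def aff_def)
  obtain \<pi> where \<pi>: "bij \<pi>" "\<And>k. g (gen (\<pi> k)) = std_labeling (gen k)"
    using magic_labeling_obtain_perm[OF g] by metis
  have "g (lin \<pi> v) = std_labeling v" for v
  proof (cases v rule: vertex_cases)
    case 1
    then show ?thesis using g(2) by (simp add: std_labeling_simps)
  next
    case (2 i)
    then show ?thesis using \<pi> by simp
  next
    case (3 i j)
    then have "\<pi> i \<noteq> \<pi> j"
      using \<pi>(1) by (simp add: bij_def inj_eq)
    then show ?thesis
      using magic_labeling_gen_add_gen[OF g, of "\<pi> i" "\<pi> j"] 3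
        magic_labeling_gen_add_gen[OF std_labeling_magic, of i j]
      by (simp add: lin_add \<pi> std_labeling_simps)
  qed
  then have "f \<circ> aff c \<pi> = std_labeling"
    by (simp add: fun_eq_iff g_def aff_def)
  then show ?thesis
    using that graph_iso_aff[OF \<pi>(1)] by blast
qed


section \<open>Arrangements on the torus\<close>

text \<open>The numeral 4 denotes 0 in this type; the Gray code below uses the names 0 to 3.\<close>

lemma UNIV_4_zero: "(UNIV :: 4 set) = {0, 1, 2, 3}"
proof -
  have "(4 :: 4) = 0" by simp
  then show ?thesis using UNIV_4 by auto
qed

text \<open>The Gray code turns each pair of coordinates into a 4-cycle.\<close>

definition ungray :: "bit \<Rightarrow> bit \<Rightarrow> 4" where
  "ungray a b = (if a = 0 then if b = 0 then 0 else 1 else if b = 0 then 3 else 2)"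

definition torus_of_vertex :: "bit ^ 4 \<Rightarrow> 4 \<times> 4" where
  "torus_of_vertex v = (ungray (v $ 1) (v $ 2), ungray (v $ 3) (v $ 4))"

text \<open>Q_4 is the product of two squares Q_2, one for each pair of coordinates, and the Gray
  code identifies each square with a 4-cycle.\<close>

lemma graph_iso_torus_of_vertex: "graph_iso hypercube torus_grid torus_of_vertex"
proof -
  have "\<forall>v w. torus_of_vertex v = torus_of_vertex w \<longrightarrow> v = w"
    unfolding forall_vec4 forall_bit by (simp add: torus_of_vertex_def ungray_def)
  then have inj: "inj torus_of_vertex"
    by (auto simp: inj_def)
  then have "card (range torus_of_vertex) = CARD(4 \<times> 4)"
    by (simp add: card_image CARD_bit)
  then have "range torus_of_vertex = UNIV"
    by (intro card_eq_UNIV_imp_eq_UNIV) simp_all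
  moreover have "\<forall>v w. hypercube v w \<longleftrightarrow> torus_grid (torus_of_vertex v) (torus_of_vertex w)"
    unfolding forall_vec4 forall_bit hypercube_iff exists_5
    by (simp add: gen_simps torus_of_vertex_def ungray_def torus_grid_def cartesian_product_def cycle4_def)
  ultimately show ?thesis
    using inj by (simp add: graph_iso_def bij_def)
qed

lemma cycle4_ungray: "cycle4 (ungray a b) (ungray (a + 1) b)" "cycle4 (ungray a b) (ungray a (b + 1))"
  by (cases a; cases b; simp add: ungray_def cycle4_def)+

text \<open>Going around a square of bits visits every element of \<open>4\<close> once, so a face
  with both directions in one coordinate pair is a full row or column.\<close>

lemma sum_ungray:
  "g (ungray a b) + g (ungray (a + 1) b) + g (ungray (a + 1) (b + 1)) + g (ungray a (b + 1)) = sum g UNIV"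
  for g :: "4 \<Rightarrow> nat"
  unfolding UNIV_4_zero by (cases a; cases b) (simp_all add: ungray_def)

text \<open>Two directions from the same coordinate pair, {1, 2} or {3, 4}, give a row or column;
  one direction from each pair gives a subsquare.\<close>

lemma magic_arrangement_face_sum:
  assumes A: "A \<in> magic_arrangements" and ij: "i \<noteq> 0" "j \<noteq> 0" "i \<noteq> j"
  shows "face_sum (A \<circ> torus_of_vertex) v i j = 34"
proof -
  have lines: "(\<Sum>y\<in>UNIV. A (x, y)) = 34" "(\<Sum>x\<in>UNIV. A (x, y)) = 34" for x y
    using A by (simp_all add: magic_arrangements_def)
  have square: "A (x, y) + A (x', y) + A (x', y') + A (x, y') = 34"
    if "cycle4 x x'" "cycle4 y y'" for x x' y y'
  proof -
    have "A (x, y) + A (x, y + 1) + A (x + 1, y) + A (x + 1, y + 1) = 34" for x y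
      using A by (simp add: magic_arrangements_def)
    \<comment> \<open>Each of the two steps may go up or down, so any of the four corners may be the
      base point of the subsquare.\<close>
    from this[of x y] this[of x' y] this[of x y'] this[of x' y'] that show ?thesis
      unfolding cycle4_def by auto
  qed
  note sum_x = sum_ungray[of "\<lambda>x. A (x, y)" for y]
  note sum_y = sum_ungray[of "\<lambda>y. A (x, y)" for x]
  have "face_sum (A \<circ> torus_of_vertex) (vec4 a b c d) i j = 34"
    if "(i, j) \<in> {(1, 2), (3, 4), (1, 3), (1, 4), (2, 3), (2, 4)}" for a b c d i j
    using that
    by (auto simp: sum_x sum_y face_sum_def gen_simps torus_of_vertex_def lines square cycle4_ungray
        simp del: add_bit_eq_xor)
  then have "face_sum (A \<circ> torus_of_vertex) v i j = 34"
    if "(i, j) \<in> {(1, 2), (3, 4), (1, 3), (1, 4), (2, 3), (2, 4)}" for i j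
    using that vec4_eta[of v] by metis
  moreover have "\<forall>i j. i \<noteq> 0 \<longrightarrow> j \<noteq> 0 \<longrightarrow> i \<noteq> j \<longrightarrow>
      (i, j) \<in> {(1, 2), (3, 4), (1, 3), (1, 4), (2, 3), (2, 4)} \<or>
      (j, i) \<in> {(1, 2), (3, 4), (1, 3), (1, 4), (2, 3), (2, 4 :: 5)}"
    unfolding forall_5 by simp
  ultimately show ?thesis
    using ij face_sum_commute by metis
qed

text \<open>The 4 rows, 4 columns and 16 subsquares are the 24 faces of Q_4. One inclusion uses the
  description of four-cycles in Q_4; the other exhibits each line and subsquare as a four-cycle, and
  the total 136 of the four rows gives the sum 34.\<close>

lemma magic_arrangements_eq: "magic_arrangements = magic_labelings torus_grid"
proof (rule subset_antisym; rule subsetI)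
  fix A assume A: "A \<in> magic_arrangements"
  have bij: "bij torus_of_vertex"
    using graph_iso_torus_of_vertex by (simp add: graph_iso_def)
  moreover have "bij_betw A UNIV {1..16}"
    using A by (simp add: magic_arrangements_def)
  ultimately have "bij_betw (A \<circ> torus_of_vertex) UNIV {1..16}"
    by (rule bij_betw_trans)
  then have "A \<circ> torus_of_vertex \<in> magic_labelings hypercube"
    using magic_arrangement_face_sum[OF A]
    unfolding hypercube_eq_cayley magic_labelings_cayley_iff by blast
  then have "A \<circ> torus_of_vertex \<circ> inv_into UNIV torus_of_vertex \<in> magic_labelings torus_grid"
    using comp_magic_labelings graph_iso_inv graph_iso_torus_of_vertex by blast
  moreover have "torus_of_vertex \<circ> inv_into UNIV torus_of_vertex = id"
    using bij by (simp add: bij_is_surj flip: surj_iff)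
  ultimately show "A \<in> magic_labelings torus_grid"
    by (simp add: comp_assoc)
next
  fix A assume "A \<in> magic_labelings torus_grid"
  then obtain s where bij: "bij_betw A UNIV {1..16}"
    and s: "\<And>a b c d. four_cycle torus_grid a b c d \<Longrightarrow> A a + A b + A c + A d = s"
    by (auto simp: magic_labelings_def)
  have row: "(\<Sum>j\<in>UNIV. A (i, j)) = s" for i
    using s[of "(i, 0)" "(i, 1)" "(i, 2)" "(i, 3)"] unfolding UNIV_4_zero
    by (simp add: four_cycle_def torus_grid_def cartesian_product_def cycle4_def)
  have col: "(\<Sum>i\<in>UNIV. A (i, j)) = s" for j
    using s[of "(0, j)" "(1, j)" "(2, j)" "(3, j)"] unfolding UNIV_4_zero
    by (simp add: four_cycle_def torus_grid_def cartesian_product_def cycle4_def)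
  have square: "A (i, j) + A (i, j + 1) + A (i + 1, j) + A (i + 1, j + 1) = s" for i j
    using s[of "(i, j)" "(i, j + 1)" "(i + 1, j + 1)" "(i + 1, j)"]
    by (simp add: four_cycle_def torus_grid_def cartesian_product_def cycle4_def)
  have "(\<Sum>i\<in>UNIV. \<Sum>j\<in>UNIV. A (i, j)) = sum A UNIV"
    by (simp add: sum.cartesian_product)
  then have "s = 34"
    unfolding row sum_labels[OF bij] by simp
  then show "A \<in> magic_arrangements"
    using bij row col square by (simp add: magic_arrangements_def)
qed


section \<open>The group actions\<close>

lemma group_Aut: "group (Aut E)"
proof (rule groupI)
  fix \<sigma> assume "\<sigma> \<in> carrier (Aut E)"
  then show "\<exists>\<tau>\<in>carrier (Aut E). \<tau> \<otimes>\<^bsub>Aut E\<^esub> \<sigma> = \<one>\<^bsub>Aut E\<^esub>"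
    using graph_iso_inv[of E E \<sigma>]
    by (intro bexI[of _ "inv_into UNIV \<sigma>"]) (auto simp: Aut_def graph_iso_def bij_is_inj)
qed (auto simp: Aut_def graph_iso_comp comp_assoc, simp add: graph_iso_def)

lemma order_Aut_folded_hypercube: "order (Aut folded_hypercube) = 1920"
  by (simp add: order_def Aut_def card_graph_iso_folded_hypercube)

lemma std_labeling_inj: "inj std_labeling"
  using std_labeling_magic by (simp add: magic_labelings_folded_hypercube_iff bij_betw_def)

text \<open>Composing \<open>std_labeling\<close> with automorphisms reaches every magic labeling by
  \<open>magic_labeling_eq_std\<close>, and each only once because \<open>std_labeling\<close> is
  injective.\<close>

lemma card_magic_labelings_folded_hypercube: "card (magic_labelings folded_hypercube) = 1920"
proof -
  let ?G = "{\<sigma>. graph_iso folded_hypercube folded_hypercube \<sigma>}"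
  have "(\<lambda>\<sigma>. std_labeling \<circ> \<sigma>) ` ?G = magic_labelings folded_hypercube"
  proof (rule subset_antisym; rule subsetI)
    fix f assume "f \<in> magic_labelings folded_hypercube"
    then obtain \<sigma> where \<sigma>: "graph_iso folded_hypercube folded_hypercube \<sigma>" "f \<circ> \<sigma> = std_labeling"
      by (rule magic_labeling_eq_std)
    have "\<sigma> \<circ> inv_into UNIV \<sigma> = id"
      using \<sigma>(1) by (simp add: graph_iso_def bij_is_surj flip: surj_iff)
    then have "f = std_labeling \<circ> inv_into UNIV \<sigma>"
      by (simp flip: \<sigma>(2) add: comp_assoc)
    then show "f \<in> (\<lambda>\<sigma>. std_labeling \<circ> \<sigma>) ` ?G"
      using graph_iso_inv[OF \<sigma>(1)] by blast
  qed (auto intro: comp_magic_labelings std_labeling_magic)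
  moreover have "inj_on (\<lambda>\<sigma>. std_labeling \<circ> \<sigma>) ?G"
    by (rule inj_onI) (metis fun.inj_map_strong std_labeling_inj injD)
  ultimately show ?thesis
    by (metis card_image card_graph_iso_folded_hypercube)
qed

lemma magic_labelings_folded_hypercube_equivalent:
  assumes "f \<in> magic_labelings folded_hypercube" "g \<in> magic_labelings folded_hypercube"
  obtains \<sigma> where "graph_iso folded_hypercube folded_hypercube \<sigma>" "g \<circ> \<sigma> = f"
proof -
  obtain \<sigma> \<tau> where \<sigma>: "graph_iso folded_hypercube folded_hypercube \<sigma>" "f \<circ> \<sigma> = std_labeling"
    and \<tau>: "graph_iso folded_hypercube folded_hypercube \<tau>" "g \<circ> \<tau> = std_labeling"
    using magic_labeling_eq_std assms by metis
  have "\<sigma> \<circ> inv_into UNIV \<sigma> = id"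
    using \<sigma>(1) by (simp add: graph_iso_def bij_is_surj flip: surj_iff)
  then have "g \<circ> (\<tau> \<circ> inv_into UNIV \<sigma>) = f"
    by (metis comp_assoc comp_id \<sigma>(2) \<tau>(2))
  then show ?thesis
    using that graph_iso_comp graph_iso_inv \<sigma>(1) \<tau>(1) by blast
qed

text \<open>Serves both actions: \<open>\<phi>\<close> is \<open>id\<close> for tesseracts and an
  isomorphism from the torus to Q_4 for arrangements. Faithfulness holds because an injective
  labeling is moved differently by different permutations.\<close>

lemma actions_of_Aut:
  fixes \<phi> :: "'p \<Rightarrow> 'v" and M :: "('v \<Rightarrow> 'l) set"
  assumes \<phi>: "bij \<phi>" and L: "L = (\<lambda>f. f \<circ> \<phi>) ` M"
    and M: "\<And>f \<sigma>. f \<in> M \<Longrightarrow> graph_iso E E \<sigma> \<Longrightarrow> f \<circ> \<sigma> \<in> M"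
  shows group_action_transported: "group_action (Aut E) L (transported_action \<phi> L)"
    and faithful_action_transported:
      "f0 \<in> M \<Longrightarrow> inj f0 \<Longrightarrow> faithful_action (Aut E) L (transported_action \<phi> L)"
    and transitive_action_transported:
      "(\<And>f g. f \<in> M \<Longrightarrow> g \<in> M \<Longrightarrow> \<exists>\<sigma>. graph_iso E E \<sigma> \<and> g \<circ> \<sigma> = f) \<Longrightarrow>
         transitive_action (Aut E) L (transported_action \<phi> L)"
proof -
  \<comment> \<open>On labelings of the form \<open>f \<circ> \<phi>\<close> the conjugation by
    \<open>\<phi>\<close> cancels.\<close>
  have act: "transported_action \<phi> L \<sigma> (f \<circ> \<phi>) = (f \<circ> inv_into UNIV \<sigma>) \<circ> \<phi>"
    if "graph_iso E E \<sigma>" "f \<in> M" for \<sigma> f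
  proof -
    have "bij \<sigma>" using that by (simp add: graph_iso_def)
    then have "inv_into UNIV (inv_into UNIV \<phi> \<circ> \<sigma> \<circ> \<phi>) = inv_into UNIV \<phi> \<circ> inv_into UNIV \<sigma> \<circ> \<phi>"
      using \<phi> by (simp add: o_inv_distrib bij_comp bij_imp_bij_inv inv_inv_eq comp_assoc)
    then show ?thesis
      using that \<phi> by (auto simp: transported_action_def labeling_action_def L fun_eq_iff
          surj_f_inv_f bij_is_surj)
  qed
  have ext: "transported_action \<phi> L \<sigma> \<in> extensional L" for \<sigma>
    by (simp add: transported_action_def labeling_action_def)
  have closed: "transported_action \<phi> L \<sigma> f \<in> L" if "graph_iso E E \<sigma>" "f \<in> L" for \<sigma> f
    using that act M graph_iso_inv unfolding L by blast
  have comp: "transported_action \<phi> L (\<sigma> \<circ> \<tau>) f = transported_action \<phi> L \<sigma> (transported_action \<phi> L \<tau> f)"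
    if \<sigma>: "graph_iso E E \<sigma>" and \<tau>: "graph_iso E E \<tau>" and f: "f \<in> L" for \<sigma> \<tau> f
  proof -
    obtain g where g: "g \<in> M" "f = g \<circ> \<phi>"
      using f L by blast
    \<comment> \<open>Inversion reverses the order and so does composition on the right; together
      they give a left action.\<close>
    have "inv_into UNIV (\<sigma> \<circ> \<tau>) = inv_into UNIV \<tau> \<circ> inv_into UNIV \<sigma>"
      using \<sigma> \<tau> by (simp add: graph_iso_def o_inv_distrib)
    then show ?thesis
      unfolding g(2) act[OF graph_iso_comp[OF \<tau> \<sigma>] g(1)] act[OF \<tau> g(1)]
        act[OF \<sigma> M[OF g(1) graph_iso_inv[OF \<tau>]]]
      by (simp add: comp_assoc)
  qed
  have Bij: "transported_action \<phi> L \<sigma> \<in> Bij L" if \<sigma>: "graph_iso E E \<sigma>" for \<sigma>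
  proof -
    have id: "transported_action \<phi> L id f = f" if "f \<in> L" for f
      using act[of id] that by (auto simp: L graph_iso_def)
    have "bij \<sigma>" using \<sigma> by (simp add: graph_iso_def)
    then have "inv_into UNIV \<sigma> \<circ> \<sigma> = id" "\<sigma> \<circ> inv_into UNIV \<sigma> = id"
      by (simp_all add: bij_is_inj bij_is_surj flip: surj_iff)
    then have "bij_betw (transported_action \<phi> L \<sigma>) L L"
      using comp[OF graph_iso_inv[OF \<sigma>] \<sigma>] comp[OF \<sigma> graph_iso_inv[OF \<sigma>]] closed \<sigma> graph_iso_inv[OF \<sigma>]
      by (intro bij_betw_byWitness[where f' = "transported_action \<phi> L (inv_into UNIV \<sigma>)"])
         (auto simp: id)
    then show ?thesis
      using ext by (simp add: Bij_def)
  qed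
  have "transported_action \<phi> L \<in> hom (Aut E) (BijGroup L)"
  proof (rule homI)
    fix \<sigma> \<tau> assume "\<sigma> \<in> carrier (Aut E)" "\<tau> \<in> carrier (Aut E)"
    then have \<sigma>\<tau>: "graph_iso E E \<sigma>" "graph_iso E E \<tau>"
      by (simp_all add: Aut_def)
    have "transported_action \<phi> L (\<sigma> \<circ> \<tau>) =
        compose L (transported_action \<phi> L \<sigma>) (transported_action \<phi> L \<tau>)"
      using comp[OF \<sigma>\<tau>] ext by (intro extensionalityI[of _ L]) (auto simp: compose_def)
    then show "transported_action \<phi> L (\<sigma> \<otimes>\<^bsub>Aut E\<^esub> \<tau>) =
        transported_action \<phi> L \<sigma> \<otimes>\<^bsub>BijGroup L\<^esub> transported_action \<phi> L \<tau>"
      using Bij \<sigma>\<tau> by (simp add: Aut_def BijGroup_def)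
  qed (simp add: Aut_def BijGroup_def Bij)
  then show action: "group_action (Aut E) L (transported_action \<phi> L)"
    by (intro group_action.intro group_hom.intro group_hom_axioms.intro group_Aut group_BijGroup)
  show "faithful_action (Aut E) L (transported_action \<phi> L)" if f0: "f0 \<in> M" "inj f0"
  proof (intro faithful_action.intro faithful_action_axioms.intro action inj_onI)
    fix \<sigma> \<tau> assume "\<sigma> \<in> carrier (Aut E)" "\<tau> \<in> carrier (Aut E)"
      and eq: "transported_action \<phi> L \<sigma> = transported_action \<phi> L \<tau>"
    then have \<sigma>\<tau>: "graph_iso E E \<sigma>" "graph_iso E E \<tau>"
      by (simp_all add: Aut_def)
    have "(f0 \<circ> inv_into UNIV \<sigma>) \<circ> \<phi> = (f0 \<circ> inv_into UNIV \<tau>) \<circ> \<phi>"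
      using act[OF \<sigma>\<tau>(1) f0(1)] act[OF \<sigma>\<tau>(2) f0(1)] eq by simp
    then have "f0 (inv_into UNIV \<sigma> v) = f0 (inv_into UNIV \<tau> v)" for v
      using \<phi> by (metis bij_pointE comp_apply)
    then have "inv_into UNIV \<sigma> = inv_into UNIV \<tau>"
      using f0(2) by (auto simp: inj_eq)
    then show "\<sigma> = \<tau>"
      using \<sigma>\<tau> by (metis graph_iso_def inv_inv_eq)
  qed
  show "transitive_action (Aut E) L (transported_action \<phi> L)"
    if trans: "\<And>f g. f \<in> M \<Longrightarrow> g \<in> M \<Longrightarrow> \<exists>\<sigma>. graph_iso E E \<sigma> \<and> g \<circ> \<sigma> = f"
  proof (intro transitive_action.intro transitive_action_axioms.intro action)
    fix x y assume "x \<in> L" "y \<in> L"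
    then obtain f g where fg: "f \<in> M" "x = f \<circ> \<phi>" "g \<in> M" "y = g \<circ> \<phi>"
      unfolding L by blast
    obtain \<sigma> where \<sigma>: "graph_iso E E \<sigma>" "g \<circ> \<sigma> = f"
      using trans[OF fg(1,3)] by blast
    have "\<sigma> \<circ> inv_into UNIV \<sigma> = id"
      using \<sigma>(1) by (simp add: graph_iso_def bij_is_surj flip: surj_iff)
    then have "f \<circ> inv_into UNIV \<sigma> = g"
      by (metis comp_assoc comp_id \<sigma>(2))
    then have "transported_action \<phi> L \<sigma> x = y"
      using act[OF \<sigma>(1) fg(1)] fg by simp
    then show "\<exists>\<sigma>\<in>carrier (Aut E). transported_action \<phi> L \<sigma> x = y"
      using \<sigma>(1) by (auto simp: Aut_def)
  qed
qed

lemma transported_action_id: "transported_action id L = labeling_action L"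
  by (simp add: transported_action_def fun_eq_iff)


section \<open>The semidirect product\<close>

lemma group_additive_group: "group (additive_group :: 'a::ab_group_add monoid)"
proof (rule groupI)
  fix x :: 'a
  show "\<exists>y\<in>carrier additive_group. y \<otimes>\<^bsub>additive_group\<^esub> x = \<one>\<^bsub>additive_group\<^esub>"
    by (intro bexI[of _ "- x"]) (simp_all add: additive_group_def)
qed (simp_all add: additive_group_def add.assoc)

lemma sum_axis: "(\<Sum>i\<in>UNIV. axis i 1) = (\<chi> i. 1 :: bit ^ 'n::finite)"
  by (simp add: vec_eq_iff axis_def sum.delta')

text \<open>The all-ones vector has order 2, so it generates only 0 and itself, which is the kernel
  of \<open>proj\<close>.\<close>

lemma generate_ones: "generate additive_group {\<Sum>i\<in>UNIV. axis i 1} = proj -` {0}"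
proof (rule subset_antisym; rule subsetI)
  fix x :: "bit ^ 5" assume "x \<in> generate additive_group {\<Sum>i\<in>UNIV. axis i 1}"
  then show "x \<in> proj -` {0}"
  proof (induction rule: generate.induct)
    case (inv h)
    have "inv\<^bsub>additive_group\<^esub> h = h"
      by (rule group.inv_equality[OF group_additive_group]) (simp_all add: additive_group_def)
    then show ?case
      using inv by (simp add: sum_axis proj_eq_0_iff)
  next
    case (eng h1 h2)
    then show ?case
      by (simp add: additive_group_def proj_add)
  qed (simp_all add: additive_group_def sum_axis proj_eq_0_iff)
next
  fix x :: "bit ^ 5" assume "x \<in> proj -` {0}"
  then consider "x = 0" | "x = (\<Sum>i\<in>UNIV. axis i 1)"
    by (auto simp: sum_axis proj_eq_0_iff)
  then show "x \<in> generate additive_group {\<Sum>i\<in>UNIV. axis i 1}"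
  proof cases
    case 1
    then show ?thesis
      using generate.one[of "additive_group :: (bit ^ 5) monoid"] by (simp add: additive_group_def)
  qed (simp add: generate.incl)
qed

text \<open>The cosets of the kernel of \<open>proj\<close> are its fibres, and \<open>proj\<close>
  is onto, so the elements of the quotient are indexed by F_2^4.\<close>

lemma carrier_C2_pow_4: "carrier C2_pow_4 = range (\<lambda>c. proj -` {c})"
proof -
  have coset: "proj -` {0} #>\<^bsub>additive_group\<^esub> a = proj -` {proj a}" for a
  proof -
    have "proj x = proj a \<longleftrightarrow> (\<exists>h. proj h = 0 \<and> x = h + a)" for x
    proof
      assume "proj x = proj a"
      then show "\<exists>h. proj h = 0 \<and> x = h + a"
        by (intro exI[of _ "x + a"]) (simp add: proj_add add.assoc)
    qed (auto simp: proj_add)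
    then show ?thesis
      by (auto simp: r_coset_def additive_group_def)
  qed
  have "carrier C2_pow_4 = range (\<lambda>a. proj -` {proj a})"
    unfolding C2_pow_4_def generate_ones FactGroup_def RCOSETS_def
    by (auto simp: coset) (auto simp: additive_group_def)
  also have "\<dots> = (\<lambda>c. proj -` {c}) ` range proj"
    by (simp add: image_image)
  finally show ?thesis
    by (simp add: surj_proj)
qed

lemma mult_C2_pow_4: "proj -` {c} \<otimes>\<^bsub>C2_pow_4\<^esub> proj -` {d} = proj -` {c + d}"
proof -
  have "proj x = c + d \<longleftrightarrow> (\<exists>h k. proj h = c \<and> proj k = d \<and> x = h + k)" for x
  proof
    assume "proj x = c + d"
    then show "\<exists>h k. proj h = c \<and> proj k = d \<and> x = h + k"
      \<comment> \<open>In characteristic 2 the vector \<open>lift c + x\<close> is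
        \<open>x - lift c\<close>, which lies over \<open>d\<close>.\<close>
      by (intro exI[of _ "lift c"] exI[of _ "lift c + x"]) (simp add: proj_add)
  qed (auto simp: proj_add)
  then show ?thesis
    by (simp add: C2_pow_4_def FactGroup_def set_mult_def additive_group_def set_eq_iff Bex_def)
qed

text \<open>Expresses the action on cosets through \<open>lin\<close>. The fibre is filled because
  the inverse permutation takes points over \<open>lin \<pi> c\<close> back to points over
  \<open>c\<close>.\<close>

lemma permute_coords_image:
  assumes "bij \<pi>"
  shows "permute_coords \<pi> ` (proj -` {c}) = proj -` {lin \<pi> c}"
proof (rule subset_antisym; rule subsetI)
  fix x assume "x \<in> permute_coords \<pi> ` (proj -` {c})"
  then show "x \<in> proj -` {lin \<pi> c}"
    by (auto simp flip: lin_proj)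
next
  fix x assume x: "x \<in> proj -` {lin \<pi> c}"
  define \<rho> where "\<rho> = inv_into UNIV \<pi>"
  have \<rho>: "bij \<rho>" "\<pi> \<circ> \<rho> = id" "\<rho> \<circ> \<pi> = id"
    using assms by (auto simp: \<rho>_def bij_imp_bij_inv bij_is_inj fun_eq_iff bij_is_surj surj_f_inv_f)
  have "x = permute_coords \<pi> (permute_coords \<rho> x)"
    using assms \<rho> by (simp add: permute_coords_comp permute_coords_id)
  moreover have "proj (permute_coords \<rho> x) = c"
    using x assms \<rho> by (simp add: lin_lin flip: lin_proj)
  ultimately show "x \<in> permute_coords \<pi> ` (proj -` {c})"
    by blast
qed

text \<open>Recovers \<open>c\<close>, as a coset, and \<open>\<pi>\<close> from
  \<open>aff c \<pi>\<close>; \<open>THE j\<close> is the direction of the image of the edge that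
  leaves 0 in direction \<open>i\<close>.\<close>

definition aut_decomp :: "(bit ^ 4 \<Rightarrow> bit ^ 4) \<Rightarrow> (bit ^ 5) set \<times> (5 \<Rightarrow> 5)" where
  "aut_decomp \<sigma> = (proj -` {\<sigma> 0}, \<lambda>i. THE j. \<sigma> (gen i) = \<sigma> 0 + gen j)"

lemma aut_decomp_aff: "bij \<pi> \<Longrightarrow> aut_decomp (aff c \<pi>) = (proj -` {c}, \<pi>)"
  by (simp add: aut_decomp_def aff_def)

text \<open>By \<open>aff_comp\<close> the pairs \<open>(c, \<pi>)\<close> multiply by the rule of
  the semidirect product, with \<open>lin\<close> as the action on F_2^4.\<close>

lemma Aut_folded_hypercube_iso: "Aut folded_hypercube \<cong> C2_pow_4_semidirect_S5"
proof (rule is_isoI, rule isoI)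
  have carrier: "carrier (Aut folded_hypercube) = (\<lambda>(c, \<pi>). aff c \<pi>) ` (UNIV \<times> {\<pi>. bij \<pi>})"
    by (simp add: Aut_def graph_iso_folded_hypercube_eq)
  have carrier': "carrier C2_pow_4_semidirect_S5 = range (\<lambda>c. proj -` {c}) \<times> {\<pi>. bij \<pi>}"
    by (simp add: C2_pow_4_semidirect_S5_def semidirect_product_def carrier_C2_pow_4 S5_def
        BijGroup_def Bij_def)
  have mult: "(proj -` {c}, \<pi>) \<otimes>\<^bsub>C2_pow_4_semidirect_S5\<^esub> (proj -` {d}, \<rho>) =
      (proj -` {c + lin \<pi> d}, \<pi> \<circ> \<rho>)" if "bij \<pi>" "bij \<rho>" for c d \<pi> \<rho>
    using that
    by (simp add: C2_pow_4_semidirect_S5_def semidirect_product_def permute_coords_image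
        mult_C2_pow_4 S5_def BijGroup_def Bij_def compose_def fun_eq_iff)
  show "aut_decomp \<in> hom (Aut folded_hypercube) C2_pow_4_semidirect_S5"
  proof (rule homI)
    fix \<sigma> \<tau> assume "\<sigma> \<in> carrier (Aut folded_hypercube)" "\<tau> \<in> carrier (Aut folded_hypercube)"
    then obtain c \<pi> d \<rho> where *: "bij \<pi>" "bij \<rho>" "\<sigma> = aff c \<pi>" "\<tau> = aff d \<rho>"
      unfolding carrier by auto
    then show "aut_decomp (\<sigma> \<otimes>\<^bsub>Aut folded_hypercube\<^esub> \<tau>) =
        aut_decomp \<sigma> \<otimes>\<^bsub>C2_pow_4_semidirect_S5\<^esub> aut_decomp \<tau>"
      by (simp add: mult aut_decomp_aff) (simp add: Aut_def aff_comp aut_decomp_aff bij_comp)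
  qed (auto simp: carrier carrier' aut_decomp_aff)
  \<comment> \<open>The fibres are nonempty because \<open>proj\<close> is onto, so different points
    have different fibres.\<close>
  have coset_eq: "proj -` {c} = proj -` {d} \<longleftrightarrow> c = d" for c d
    by (metis proj_lift singletonD singletonI vimage_eq)
  have "inj_on aut_decomp (carrier (Aut folded_hypercube))"
  proof (rule inj_onI)
    fix \<sigma> \<tau> assume "\<sigma> \<in> carrier (Aut folded_hypercube)" "\<tau> \<in> carrier (Aut folded_hypercube)"
      and eq: "aut_decomp \<sigma> = aut_decomp \<tau>"
    then obtain c \<pi> d \<rho> where *: "bij \<pi>" "bij \<rho>" "\<sigma> = aff c \<pi>" "\<tau> = aff d \<rho>"
      unfolding carrier by auto
    then show "\<sigma> = \<tau>"
      using eq by (simp add: aut_decomp_aff coset_eq)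
  qed
  moreover have "aut_decomp ` carrier (Aut folded_hypercube) =
      map_prod (\<lambda>c. proj -` {c}) id ` (UNIV \<times> {\<pi>. bij \<pi>})"
    unfolding carrier image_image
    by (rule image_cong) (simp_all add: aut_decomp_aff split_beta mem_Times_iff map_prod_def)
  moreover have "\<dots> = carrier C2_pow_4_semidirect_S5"
    unfolding carrier' by (rule map_prod_surj_on) simp_all
  ultimately show
    "bij_betw aut_decomp (carrier (Aut folded_hypercube)) (carrier C2_pow_4_semidirect_S5)"
    by (simp add: bij_betw_def)
qed

section \<open>Counts and group actions for tesseracts and arrangements\<close>

theorem theorem7:
  shows "card magic_faced_tesseracts = 2 ^ 4 * fact 5 \<and>
         (2::nat) ^ 4 * fact 5 = 1920 \<and>
         card magic_arrangements = 1920 \<and>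
         Aut folded_hypercube \<cong> C2_pow_4_semidirect_S5 \<and>
         order (Aut folded_hypercube) = 1920 \<and>
         faithful_action (Aut folded_hypercube) magic_faced_tesseracts
           (labeling_action magic_faced_tesseracts) \<and>
         transitive_action (Aut folded_hypercube) magic_faced_tesseracts
           (labeling_action magic_faced_tesseracts) \<and>
         (\<exists>\<phi>. graph_iso torus_grid hypercube \<phi>) \<and>
         (\<forall>\<phi>. graph_iso torus_grid hypercube \<phi> \<longrightarrow>
           bij_betw (\<lambda>f. f \<circ> \<phi>) magic_faced_tesseracts magic_arrangements \<and>
           faithful_action (Aut folded_hypercube) magic_arrangements
             (transported_action \<phi> magic_arrangements) \<and>
           transitive_action (Aut folded_hypercube) magic_arrangements
             (transported_action \<phi> magic_arrangements))"
proof (intro conjI allI impI)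
  let ?M = "magic_labelings folded_hypercube"
  \<comment> \<open>Passing to the labelings of FQ_4 makes their invariance under its automorphisms
    immediate.\<close>
  have M: "magic_faced_tesseracts = ?M"
    unfolding magic_labelings_hypercube[symmetric]
    unfolding magic_faced_tesseracts_def magic_labelings_def ..
  show fact: "(2::nat) ^ 4 * fact 5 = 1920"
    by (simp add: fact_numeral)
  show "card magic_faced_tesseracts = 2 ^ 4 * fact 5"
    by (simp only: M card_magic_labelings_folded_hypercube fact)
  show "\<exists>\<phi>. graph_iso torus_grid hypercube \<phi>"
    using graph_iso_inv[OF graph_iso_torus_of_vertex] by blast
  have bij: "bij_betw (\<lambda>f. f \<circ> \<phi>) ?M magic_arrangements" if "graph_iso torus_grid hypercube \<phi>" for \<phi>
    using bij_betw_comp_magic_labelings[OF that]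
    by (simp add: magic_labelings_hypercube magic_arrangements_eq)
  show "card magic_arrangements = 1920"
    using bij_betw_same_card[OF bij[OF graph_iso_inv[OF graph_iso_torus_of_vertex]]]
    by (simp add: card_magic_labelings_folded_hypercube)
  have closed: "f \<circ> \<sigma> \<in> ?M" if "f \<in> ?M" "graph_iso folded_hypercube folded_hypercube \<sigma>" for f \<sigma>
    using comp_magic_labelings that by blast
  have trans: "\<exists>\<sigma>. graph_iso folded_hypercube folded_hypercube \<sigma> \<and> g \<circ> \<sigma> = f"
    if "f \<in> ?M" "g \<in> ?M" for f g
    using magic_labelings_folded_hypercube_equivalent[OF that] by metis
  \<comment> \<open>Puts the tesseracts into the form required by \<open>actions_of_Aut\<close>,
    with \<open>\<phi> = id\<close>.\<close>
  have id: "?M = (\<lambda>f. f \<circ> id) ` ?M" by simp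
  show "faithful_action (Aut folded_hypercube) magic_faced_tesseracts
      (labeling_action magic_faced_tesseracts)"
    using faithful_action_transported[OF bij_id id closed std_labeling_magic std_labeling_inj]
    by (simp add: M transported_action_id)
  show "transitive_action (Aut folded_hypercube) magic_faced_tesseracts
      (labeling_action magic_faced_tesseracts)"
    using transitive_action_transported[OF bij_id id closed trans]
    by (simp add: M transported_action_id)
  fix \<phi> assume \<phi>: "graph_iso torus_grid hypercube \<phi>"
  have bij_\<phi>: "bij \<phi>" using \<phi> by (simp add: graph_iso_def)
  have img: "magic_arrangements = (\<lambda>f. f \<circ> \<phi>) ` ?M"
    using bij[OF \<phi>] by (simp add: bij_betw_def)
  show "bij_betw (\<lambda>f. f \<circ> \<phi>) magic_faced_tesseracts magic_arrangements"
    using bij[OF \<phi>] by (simp add: M)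
  show "faithful_action (Aut folded_hypercube) magic_arrangements
      (transported_action \<phi> magic_arrangements)"
    by (rule faithful_action_transported[OF bij_\<phi> img closed std_labeling_magic std_labeling_inj])
  show "transitive_action (Aut folded_hypercube) magic_arrangements
      (transported_action \<phi> magic_arrangements)"
    by (rule transitive_action_transported[OF bij_\<phi> img closed trans])
qed (fact Aut_folded_hypercube_iso order_Aut_folded_hypercube)+

end
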